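(* Let $M$ be an integer with $M+1\ge 2$ such that $M+1$ is congruent to $1$ or $4$ modulo $5$. Then $$ \begin{aligned} 1&+q\,\frac{\left(\sum_{i=0}^{M-1}q^i\right)+tq^{M}}{1-tq^{M+1}} +\sum_{k=2}^M q^{k^2}\,\frac{[M+1]_q}{1-tq^{M+1}}\cdot\frac{1}{\prod_{i=2}^{k}(1-q^i)}\\ &+\sum_{k=M+1}^\infty \frac{q^{k^2}}{(1-tq^{M+1})\prod_{1\le i\le k,\ i\ne M+1}(1-q^i)} =\frac{1-q^{M+1}}{1-tq^{M+1}}\prod_{k=0}^\infty\frac{1}{(1-q^{5k+1})(1-q^{5k+4})}. \end{aligned} $$
   Context: $[n]_q=1+q+\cdots+q^{n-1}$ for a positive integer $n$. The identity is one of formal power series in $q$ with coefficients in $\mathbb{Z}[t]$. *)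

theory Defs
  imports "HOL-Analysis.Analysis" "HOL-Number_Theory.Cong"
begin

text \<open>Power series in \<open>q\<close> with coefficients in \<open>\<int>[t]\<close> are elements of \<^typ>\<open>int poly fps\<close>.\<close>

abbreviation q :: "int poly fps" where
  "q \<equiv> fps_X"

abbreviation t :: "int poly fps" where
  "t \<equiv> fps_const [:0, 1:]"

definition qint :: "nat \<Rightarrow> int poly fps" where
  "qint n = (\<Sum>i<n. q ^ i)"

text \<open>
  The coefficient ring \<open>\<int>[t]\<close> has no \<open>inverse\<close> operation, so the library's division on
  \<open>fps\<close> is not available.  Every denominator below has constant coefficient \<open>1\<close>; for those the
  library's \<open>fps_right_inverse\<close>, started at \<open>1\<close>, gives the inverse.  For other
  denominators \<open>f \<oslash> g\<close> has no meaning.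
\<close>

definition fps_quot :: "'a::comm_ring_1 fps \<Rightarrow> 'a fps \<Rightarrow> 'a fps"  (infixl \<open>\<oslash>\<close> 70) where
  "f \<oslash> g = f * fps_right_inverse g 1"

lemma fps_quot_eq_iff:
  assumes "fps_nth g 0 = 1"
  shows "h = f \<oslash> g \<longleftrightarrow> h * g = f"
proof -
  have *: "g * fps_right_inverse g 1 = 1"
    by (rule fps_right_inverse) (use assms in simp)
  show ?thesis
  proof
    assume "h = f \<oslash> g"
    then show "h * g = f"
      using * by (simp add: fps_quot_def mult.assoc mult.commute mult.left_commute)
  next
    assume "h * g = f"
    then have "f \<oslash> g = h * (g * fps_right_inverse g 1)"
      by (auto simp only: fps_quot_def mult.assoc)
    then show "h = f \<oslash> g"
      using * by simp
  qed
qed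

text \<open>
  \<open>suminf\<close> and \<open>prodinf\<close> are taken in the \<open>q\<close>-adic topology of \<open>fps\<close>, and are unspecified
  on divergent arguments.  The series and the product of the identity do converge:
\<close>

lemma fps_nth_0_prod_eq_1:
  fixes f :: "'b \<Rightarrow> 'a::comm_ring_1 fps"
  assumes "\<And>i. i \<in> A \<Longrightarrow> fps_nth (f i) 0 = 1"
  shows "fps_nth (\<Prod>i\<in>A. f i) 0 = 1"
  using assms by (induction A rule: infinite_finite_induct) auto

lemma fps_quot_nth_0:
  assumes "fps_nth g 0 = 1"
  shows "fps_nth (f \<oslash> g) 0 = fps_nth f 0"
  using assms by (simp add: fps_quot_def)

lemma fps_sequence_converges:
  fixes s :: "nat \<Rightarrow> 'a::ab_group_add fps"
  assumes "\<And>n k. n \<le> k \<Longrightarrow> fps_nth (s (Suc k)) n = fps_nth (s k) n"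
  shows "s \<longlonglongrightarrow> Abs_fps (\<lambda>n. fps_nth (s n) n)"
  unfolding tendsto_fps_iff
proof
  fix n
  have "fps_nth (s k) n = fps_nth (Abs_fps (\<lambda>n. fps_nth (s n) n)) n" if "n \<le> k" for k
    using that
  proof (induction k rule: dec_induct)
    case (step k)
    then show ?case
      using assms[of n k] by (simp only:)
  qed simp
  then show "\<forall>\<^sub>F k in sequentially.
      fps_nth (s k) n = fps_nth (Abs_fps (\<lambda>n. fps_nth (s n) n)) n"
    by (rule eventually_sequentiallyI)
qed

lemma series_summable:
  "summable (\<lambda>k. q ^ (k + M + 1)\<^sup>2 \<oslash>
     ((1 - t * q ^ (M + 1)) * (\<Prod>i\<in>{1..k + M + 1} - {M + 1}. 1 - q ^ i)))"
  (is "summable ?f")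
proof -
  have nth: "fps_nth (?f k) n = 0" if "n \<le> k" for n k
  proof -
    have "n < k + M + 1"
      using that by simp
    also have "\<dots> \<le> (k + M + 1)\<^sup>2"
      by (rule self_le_power) simp_all
    finally have "n < (k + M + 1)\<^sup>2" .
    then show ?thesis
      unfolding fps_quot_def fps_X_power_mult_nth by simp
  qed
  have "(\<lambda>m. \<Sum>k<m. ?f k) \<longlonglongrightarrow> Abs_fps (\<lambda>n. fps_nth (\<Sum>k<n. ?f k) n)"
    by (rule fps_sequence_converges) (simp only: sum.lessThan_Suc fps_add_nth nth add_0_right)
  then show ?thesis
    by (auto simp: summable_def sums_def)
qed

lemma product_convergent:
  "convergent_prod (\<lambda>k. 1 \<oslash> ((1 - q ^ (5 * k + 1)) * (1 - q ^ (5 * k + 4))))"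
  (is "convergent_prod ?f")
proof -
  define r where "r k = q ^ (4 * k) + q ^ (4 * k + 3) - q ^ (9 * k + 4)" for k
  have d: "(1 - q ^ (5 * k + 1)) * (1 - q ^ (5 * k + 4)) = 1 - q ^ (k + 1) * r k" for k
  proof -
    have e: "5 * k + 1 = k + 1 + 4 * k" "5 * k + 4 = k + 1 + (4 * k + 3)"
        "5 * k + 1 + (5 * k + 4) = k + 1 + (9 * k + 4)"
      by simp_all
    have "(1 - a) * (1 - b) = 1 - (a + b - a * b)" for a b :: "int poly fps"
      by (simp add: algebra_simps)
    then have "(1 - q ^ (5 * k + 1)) * (1 - q ^ (5 * k + 4)) =
        1 - (q ^ (5 * k + 1) + q ^ (5 * k + 4) - q ^ (5 * k + 1 + (5 * k + 4)))"
      unfolding power_add[of q "5 * k + 1" "5 * k + 4"] .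
    also have "\<dots> = 1 - (q ^ (k + 1 + 4 * k) + q ^ (k + 1 + (4 * k + 3)) - q ^ (k + 1 + (9 * k + 4)))"
      by (simp only: e(3)) (simp only: e(1,2))
    also have "\<dots> = 1 - q ^ (k + 1) * r k"
      unfolding r_def right_diff_distrib distrib_left power_add[of q "k + 1"] by (rule refl)
    finally show ?thesis .
  qed
  have f: "?f k = 1 + q ^ (k + 1) * (r k * ?f k)" for k
  proof -
    have "fps_nth ((1 - q ^ (5 * k + 1)) * (1 - q ^ (5 * k + 4))) 0 = 1"
      by simp
    then have "?f k * (1 - q ^ (k + 1) * r k) = 1"
      unfolding d[symmetric] by (rule fps_quot_eq_iff[THEN iffD1, OF _ refl])
    moreover have "h = 1 + a * (b * h)" if "h * (1 - a * b) = 1" for a b h :: "int poly fps"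
      using that by (simp add: algebra_simps)
    ultimately show ?thesis
      by blast
  qed
  have f0: "fps_nth (?f k) 0 = 1" for k
    by (subst fps_quot_nth_0) simp_all
  define P where "P m = (\<Prod>k\<le>m. ?f k)" for m
  have "fps_nth (P (Suc k)) n = fps_nth (P k) n" if "n \<le> k" for n k
  proof -
    have "P (Suc k) = P k * (1 + q ^ (Suc k + 1) * (r (Suc k) * ?f (Suc k)))"
      unfolding P_def prod.atMost_Suc by (rule arg_cong[OF f])
    also have "\<dots> = P k + q ^ (Suc k + 1) * (P k * (r (Suc k) * ?f (Suc k)))"
      unfolding distrib_left mult_1_right by (simp only: mult.left_commute)
    finally show ?thesis
      using that by (simp only: fps_add_nth fps_X_power_mult_nth if_True split: if_split) simp
  qed
  then have "P \<longlonglongrightarrow> Abs_fps (\<lambda>n. fps_nth (P n) n)"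
    by (rule fps_sequence_converges)
  moreover have "fps_nth (P 0) 0 = 1"
    unfolding P_def by (rule fps_nth_0_prod_eq_1) (rule f0)
  then have "Abs_fps (\<lambda>n. fps_nth (P n) n) \<noteq> 0"
    by (metis fps_nth_Abs_fps fps_zero_nth zero_neq_one)
  ultimately have "raw_has_prod ?f 0 (Abs_fps (\<lambda>n. fps_nth (P n) n))"
    unfolding raw_has_prod_def P_def add_0_right by blast
  then show ?thesis
    unfolding convergent_prod_def by blast
qed

end

(* After multiplication by (1 - t q^(M+1)) / (1 - q^(M+1)) the left-hand side is the sum of
   q^(k^2) / (q;q)_k over all k >= 0, so the identity is the first Rogers-Ramanujan identity.
   Bailey's lemma, applied twice to the unit Bailey pair, gives for every n
     sum_{s<=n} q^(s^2) / ((q)_{n-s} (q)_s)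
       = sum_{|j|<=n} (-1)^j q^(2 j^2 + j(j-1)/2) / ((q)_{n-j} (q)_{n+j}).
   Since |j| is at most the exponent of q, replacing (q)_{n-j} and (q)_{n+j} by (q)_n changes
   the right-hand side only from the order q^n on.  The same happens in the finite Jacobi
   triple product with base q^5, whose product side has the factors 1 - q^i with i = 2, 3
   mod 5.  Eliminating the theta sum proves the identity modulo q^n for each n. *)

theory Submission
  imports Defs
begin

section \<open>Inverse q-factorials, q-Vandermonde and the finite q-binomial theorem\<close>

text \<open>
  The value \<open>0\<close> at negative arguments makes the recurrence \<open>inv_qfact_pred\<close> hold at \<open>n = 0\<close> too,
  so sums of products of these terms need no boundary cases.
\<close>

definition inv_qfact :: "'a::comm_ring_1 fps \<Rightarrow> int \<Rightarrow> 'a fps" where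
  "inv_qfact p n = (if n < 0 then 0 else 1 \<oslash> (\<Prod>i=1..nat n. 1 - p ^ i))"

lemma inv_qfact_neg [simp]: "n < 0 \<Longrightarrow> inv_qfact p n = 0"
  by (simp add: inv_qfact_def)

lemma fps_quot_mult_cancel:
  assumes "fps_nth g 0 = 1"
  shows "f \<oslash> g * g = f"
  using fps_quot_eq_iff[OF assms] by blast

lemma inv_qfact_mult:
  assumes "fps_nth p 0 = 0"
  shows "inv_qfact p (int n) * (\<Prod>i=1..n. 1 - p ^ i) = 1"
proof -
  have "fps_nth (\<Prod>i=1..n. 1 - p ^ i) 0 = 1"
    by (rule fps_nth_0_prod_eq_1) (use assms in \<open>simp add: startsby_zero_power\<close>)
  then show ?thesis
    by (simp add: inv_qfact_def fps_quot_mult_cancel)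
qed

lemma inv_qfact_0 [simp]: "inv_qfact p 0 = 1"
  using fps_quot_mult_cancel[of 1 1] by (simp add: inv_qfact_def)

lemma inv_qfact_pred:
  assumes "fps_nth p 0 = 0"
  shows "(1 - p ^ n) * inv_qfact p (int n) = inv_qfact p (int n - 1)"
proof (cases n)
  case (Suc m)
  let ?P = "\<lambda>n. \<Prod>i=1..n. 1 - p ^ i"
  have "(1 - p ^ n) * inv_qfact p (int n) =
      (1 - p ^ n) * inv_qfact p (int n) * (inv_qfact p (int m) * ?P m)"
    using assms by (simp only: inv_qfact_mult mult_1_right)
  also have "\<dots> = inv_qfact p (int m) * (inv_qfact p (int n) * ?P n)"
    by (simp add: Suc mult_ac)
  finally show ?thesis
    using assms by (simp only: inv_qfact_mult) (simp add: Suc)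
qed simp

lemma one_minus_power_cancel:
  fixes p :: "'a::idom fps"
  assumes "fps_nth p 0 = 0" "(1 - p ^ Suc n) * a = (1 - p ^ Suc n) * b"
  shows "a = b"
proof -
  have "fps_nth (1 - p ^ Suc n) 0 \<noteq> 0"
    using assms(1) by simp
  then have "1 - p ^ Suc n \<noteq> 0"
    by (metis fps_zero_nth)
  then show ?thesis
    using assms(2) by simp
qed

text \<open>The q-Pascal rule for inverse factorials. With A = p^(n+1-i) and B = p^i, write 1 - A B
  = (1 - A) + A (1 - B); each bracket lowers one index.\<close>

lemma qfact_pair_split:
  fixes p :: "'a::comm_ring_1 fps"
  assumes "fps_nth p 0 = 0" "i \<le> Suc n"
  shows "(1 - p ^ Suc n) * (inv_qfact p (int (Suc n) - int i) * inv_qfact p (int i)) =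
    inv_qfact p (int n - int i) * inv_qfact p (int i) +
    p ^ (Suc n - i) * (inv_qfact p (int (Suc n) - int i) * inv_qfact p (int i - 1))"
proof -
  have p: "p ^ (Suc n - i) * p ^ i = p ^ Suc n"
    using assms(2) by (metis le_add_diff_inverse2 power_add)
  have a: "(1 - p ^ (Suc n - i)) * inv_qfact p (int (Suc n) - int i) = inv_qfact p (int n - int i)"
    using inv_qfact_pred[OF assms(1), of "Suc n - i"] assms(2) by (simp add: of_nat_diff)
  have "(1 - A * B) * (F * G) = (1 - A) * F * G + A * (F * ((1 - B) * G))" for A B F G :: "'a fps"
    by (simp add: algebra_simps)
  then show ?thesis
    unfolding a[symmetric] inv_qfact_pred[OF assms(1), of i, symmetric] p[symmetric] .
qed

text \<open>Induction on n for all m at once: the q-Pascal rule turns the sum at (n+1, m) into those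
  at (n, m) and (n, m+1), the latter weighted by p^(n+1+m).\<close>

lemma q_vandermonde:
  fixes p :: "'a::idom fps"
  assumes p: "fps_nth p 0 = 0"
  shows "(\<Sum>i\<le>n. p ^ (i * (i + m)) * inv_qfact p (int n - int i) * inv_qfact p (int i) *
            inv_qfact p (int (i + m))) = inv_qfact p (int n) * inv_qfact p (int (n + m))"
proof (induction n arbitrary: m)
  case (Suc n)
  let ?F = "inv_qfact p"
  define V where "V n m = (\<Sum>i\<le>n. p ^ (i * (i + m)) * ?F (int n - int i) * ?F (int i) *
            ?F (int (i + m)))" for n m :: nat
  have "(1 - p ^ Suc n) * V (Suc n) m =
     (\<Sum>i\<le>Suc n. p ^ (i * (i + m)) * ?F (int (i + m)) *
       ((1 - p ^ Suc n) * (?F (int (Suc n) - int i) * ?F (int i))))"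
    unfolding V_def sum_distrib_left by (rule sum.cong, simp) (simp only: mult_ac)
  also have "\<dots> = (\<Sum>i\<le>Suc n. p ^ (i * (i + m)) * ?F (int (i + m)) *
       (?F (int n - int i) * ?F (int i)))
     + (\<Sum>i\<le>Suc n. p ^ (i * (i + m)) * ?F (int (i + m)) *
        (p ^ (Suc n - i) * (?F (int (Suc n) - int i) * ?F (int i - 1))))"
    unfolding sum.distrib[symmetric]
    by (rule sum.cong, simp, subst qfact_pair_split[OF p]) (simp_all only: atMost_iff distrib_left)
  \<comment> \<open>The term i = n + 1 vanishes here, and the term i = 0 in the other sum: each
    contains \<open>inv_qfact\<close> at -1.\<close>
  also have "(\<Sum>i\<le>Suc n. p ^ (i * (i + m)) * ?F (int (i + m)) *
       (?F (int n - int i) * ?F (int i))) = V n m"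
    unfolding V_def by (simp add: mult_ac)
  also have "(\<Sum>i\<le>Suc n. p ^ (i * (i + m)) * ?F (int (i + m)) *
        (p ^ (Suc n - i) * (?F (int (Suc n) - int i) * ?F (int i - 1))))
      = (\<Sum>i\<le>n. p ^ (Suc i * (Suc i + m)) * ?F (int (Suc i + m)) *
        (p ^ (n - i) * (?F (int n - int i) * ?F (int i))))"
    by (subst sum.atMost_Suc_shift) simp
  also have "\<dots> = p ^ (Suc n + m) * V n (Suc m)"
    unfolding V_def sum_distrib_left
  proof (rule sum.cong, simp)
    fix i assume "i \<in> {..n}"
    then have "Suc i * (Suc i + m) + (n - i) = Suc n + m + i * (i + Suc m)"
      by (simp add: algebra_simps)
    then have "p ^ (Suc i * (Suc i + m)) * p ^ (n - i) = p ^ (Suc n + m) * p ^ (i * (i + Suc m))"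
      by (simp only: power_add[symmetric])
    then show "p ^ (Suc i * (Suc i + m)) * ?F (int (Suc i + m)) *
        (p ^ (n - i) * (?F (int n - int i) * ?F (int i))) =
      p ^ (Suc n + m) * (p ^ (i * (i + Suc m)) * ?F (int n - int i) * ?F (int i) *
            ?F (int (i + Suc m)))"
      by (simp add: mult_ac) (metis mult.assoc mult.commute)
  qed
  also have "V n m = ?F (int n) * ?F (int (n + m))"
    unfolding V_def by (rule Suc.IH)
  also have "V n (Suc m) = ?F (int n) * ?F (int (n + Suc m))"
    unfolding V_def by (rule Suc.IH)
  \<comment> \<open>With all indices raised, the two terms combine as (1 - P) + P = 1, where P =
    p^(n+1+m).\<close>
  also have "?F (int n) = (1 - p ^ Suc n) * ?F (int (Suc n))"
    using inv_qfact_pred[OF p, of "Suc n"] by simp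
  also have "?F (int (n + m)) = (1 - p ^ (Suc n + m)) * ?F (int (Suc n + m))"
    using inv_qfact_pred[OF p, of "Suc n + m"] by simp
  finally have "(1 - p ^ Suc n) * V (Suc n) m =
      (1 - p ^ Suc n) * (?F (int (Suc n)) * ?F (int (Suc n + m)))"
    by (simp add: algebra_simps)
  then show ?case
    unfolding V_def by (rule one_minus_power_cancel[OF p])
qed simp

text \<open>
  Homogeneous in \<open>x\<close> and \<open>u\<close>, so that the centred case \<open>u = p\<^sup>N\<close> needs no negative powers of \<open>p\<close>.
\<close>

lemma q_binomial:
  fixes p u x :: "'a::idom fps"
  assumes p: "fps_nth p 0 = 0"
  shows "(\<Sum>k\<le>n. p ^ (k choose 2) * x ^ k * u ^ (n - k) *
            (inv_qfact p (int n - int k) * inv_qfact p (int k)))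
    = inv_qfact p (int n) * (\<Prod>i<n. u + x * p ^ i)"
proof (induction n)
  case (Suc n)
  let ?F = "inv_qfact p"
  define W where "W n = (\<Sum>k\<le>n. p ^ (k choose 2) * x ^ k * u ^ (n - k) *
            (?F (int n - int k) * ?F (int k)))" for n :: nat
  have "(1 - p ^ Suc n) * W (Suc n) =
     (\<Sum>k\<le>Suc n. p ^ (k choose 2) * x ^ k * u ^ (Suc n - k) *
       ((1 - p ^ Suc n) * (?F (int (Suc n) - int k) * ?F (int k))))"
    unfolding W_def sum_distrib_left by (rule sum.cong, simp) (simp only: mult_ac)
  also have "\<dots> = (\<Sum>k\<le>Suc n. p ^ (k choose 2) * x ^ k * u ^ (Suc n - k) *
       (?F (int n - int k) * ?F (int k)))
     + (\<Sum>k\<le>Suc n. p ^ (k choose 2) * x ^ k * u ^ (Suc n - k) *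
        (p ^ (Suc n - k) * (?F (int (Suc n) - int k) * ?F (int k - 1))))"
    unfolding sum.distrib[symmetric]
    by (rule sum.cong, simp, subst qfact_pair_split[OF p]) (simp_all only: atMost_iff distrib_left)
  \<comment> \<open>The term k = n + 1 vanishes here and k = 0 in the other sum; together they yield
    the new factor u + x p^n.\<close>
  also have "(\<Sum>k\<le>Suc n. p ^ (k choose 2) * x ^ k * u ^ (Suc n - k) *
       (?F (int n - int k) * ?F (int k))) = u * W n"
    unfolding W_def sum_distrib_left
    by (subst sum.atMost_Suc) (auto simp: Suc_diff_le mult_ac intro!: sum.cong)
  also have "(\<Sum>k\<le>Suc n. p ^ (k choose 2) * x ^ k * u ^ (Suc n - k) *
        (p ^ (Suc n - k) * (?F (int (Suc n) - int k) * ?F (int k - 1))))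
      = (\<Sum>k\<le>n. p ^ (Suc k choose 2) * x ^ Suc k * u ^ (n - k) *
        (p ^ (n - k) * (?F (int n - int k) * ?F (int k))))"
    by (subst sum.atMost_Suc_shift) simp
  also have "\<dots> = x * p ^ n * W n"
    unfolding W_def sum_distrib_left
  proof (rule sum.cong, simp)
    fix k assume "k \<in> {..n}"
    then have "(Suc k choose 2) + (n - k) = n + (k choose 2)"
      by (simp add: numeral_2_eq_2)
    then have "p ^ (Suc k choose 2) * p ^ (n - k) = p ^ n * p ^ (k choose 2)"
      by (simp only: power_add[symmetric])
    then show "p ^ (Suc k choose 2) * x ^ Suc k * u ^ (n - k) *
        (p ^ (n - k) * (?F (int n - int k) * ?F (int k))) =
      x * p ^ n * (p ^ (k choose 2) * x ^ k * u ^ (n - k) * (?F (int n - int k) * ?F (int k)))"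
      by (simp add: mult_ac)
  qed
  finally have "(1 - p ^ Suc n) * W (Suc n) = (u + x * p ^ n) * W n"
    by (simp add: distrib_right)
  also have "W n = ?F (int n) * (\<Prod>i<n. u + x * p ^ i)"
    unfolding W_def by (rule Suc.IH)
  also have "?F (int n) = (1 - p ^ Suc n) * ?F (int (Suc n))"
    using inv_qfact_pred[OF p, of "Suc n"] by simp
  finally have "(1 - p ^ Suc n) * W (Suc n) =
      (1 - p ^ Suc n) * (?F (int (Suc n)) * (\<Prod>i<Suc n. u + x * p ^ i))"
    by (simp add: mult_ac)
  then show ?case
    unfolding W_def by (rule one_minus_power_cancel[OF p])
qed (simp add: numeral_2_eq_2)

text \<open>With a = |j|, the terms s < a vanish, and s = a + i splits s^2 as a^2 + i (i + 2 a), so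
  \<open>q_vandermonde\<close> applies with n - a and 2 a. The factorial pair is even in j.\<close>

lemma q_vandermonde_int:
  fixes p :: "'a::idom fps"
  assumes p: "fps_nth p 0 = 0" and j: "\<bar>j\<bar> \<le> int n"
  shows "(\<Sum>s\<le>n. p ^ s\<^sup>2 * inv_qfact p (int n - int s) *
             (inv_qfact p (int s - j) * inv_qfact p (int s + j)))
    = p ^ nat (j\<^sup>2) * (inv_qfact p (int n - j) * inv_qfact p (int n + j))"
proof -
  let ?F = "inv_qfact p"
  define f where "f a s = p ^ s\<^sup>2 * ?F (int n - int s) * (?F (int s - int a) * ?F (int s + int a))"
    for a s :: nat
  have *: "(\<Sum>s\<le>n. f a s) = p ^ a\<^sup>2 * (?F (int n - int a) * ?F (int n + int a))" if a: "a \<le> n" for a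
  proof -
    obtain m where n: "n = a + m"
      using le_Suc_ex[OF a] by blast
    have "(\<Sum>s\<le>n. f a s) = (\<Sum>s\<in>{a..n}. f a s)"
    proof (rule sum.mono_neutral_right)
      show "\<forall>s\<in>{..n} - {a..n}. f a s = 0"
        by (auto simp: f_def)
    qed auto
    also have "\<dots> = (\<Sum>i\<le>m. f a (a + i))"
      by (rule sum.reindex_bij_witness[of _ "\<lambda>i. a + i" "\<lambda>s. s - a"]) (auto simp: n)
    also have "\<dots> = (\<Sum>i\<le>m. p ^ a\<^sup>2 * (p ^ (i * (i + 2 * a)) * ?F (int m - int i) * ?F (int i) *
        ?F (int (i + 2 * a))))"
    proof (rule sum.cong, simp)
      fix i
      have "(a + i)\<^sup>2 = a\<^sup>2 + i * (i + 2 * a)"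
        by (simp add: power2_eq_square algebra_simps)
      then have e: "p ^ (a + i)\<^sup>2 = p ^ a\<^sup>2 * p ^ (i * (i + 2 * a))"
        by (simp only: power_add)
      have i: "int (a + i) - int a = int i" "int (a + i) + int a = int (i + 2 * a)"
          "int n - int (a + i) = int m - int i"
        by (simp_all add: n)
      show "f a (a + i) = p ^ a\<^sup>2 * (p ^ (i * (i + 2 * a)) * ?F (int m - int i) * ?F (int i) *
        ?F (int (i + 2 * a)))"
        unfolding f_def e i by (simp only: mult_ac)
    qed
    also have "\<dots> = p ^ a\<^sup>2 * (?F (int n - int a) * ?F (int n + int a))"
      unfolding sum_distrib_left[symmetric] q_vandermonde[OF p] by (simp add: n algebra_simps)
    finally show ?thesis .
  qed
  obtain a where a: "j = int a \<or> j = - int a"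
    by (cases j rule: int_cases2) auto
  have "?F (k - j) * ?F (k + j) = ?F (k - int a) * ?F (k + int a)" for k
    using a by (elim disjE) (simp_all only: minus_minus diff_minus_eq_add add_uminus_conv_diff mult.commute)
  moreover have "nat (j\<^sup>2) = a\<^sup>2"
    using a by (elim disjE) (simp_all add: nat_power_eq)
  moreover have "a \<le> n"
    using a j by auto
  ultimately show ?thesis
    using * by (simp only: f_def)
qed

section \<open>Bailey pairs and Bailey's lemma\<close>

text \<open>Bailey pairs relative to 1 in bilateral form: the classical \<alpha> at r > 0 is
  \<open>\<alpha> r + \<alpha> (- r)\<close>, since the kernel is even in j.\<close>

definition bailey_pair :: "'a::comm_ring_1 fps \<Rightarrow> (int \<Rightarrow> 'a fps) \<Rightarrow> (nat \<Rightarrow> 'a fps) \<Rightarrow> bool" where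
  "bailey_pair p \<alpha> \<beta> \<longleftrightarrow>
     (\<forall>n. \<beta> n = (\<Sum>j=-int n..int n. \<alpha> j * (inv_qfact p (int n - j) * inv_qfact p (int n + j))))"

text \<open>Bailey's lemma with both free parameters sent to infinity. After exchanging the sums,
  the inner one is \<open>q_vandermonde_int\<close>.\<close>

lemma bailey_step:
  fixes p :: "'a::idom fps"
  assumes p: "fps_nth p 0 = 0" and ab: "bailey_pair p \<alpha> \<beta>"
  shows "bailey_pair p (\<lambda>j. p ^ nat (j\<^sup>2) * \<alpha> j)
           (\<lambda>n. \<Sum>s\<le>n. p ^ s\<^sup>2 * inv_qfact p (int n - int s) * \<beta> s)"
  unfolding bailey_pair_def
proof
  fix n
  let ?F = "inv_qfact p"
  have "(\<Sum>s\<le>n. p ^ s\<^sup>2 * ?F (int n - int s) * \<beta> s)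
    = (\<Sum>s\<le>n. p ^ s\<^sup>2 * ?F (int n - int s) *
        (\<Sum>j=-int n..int n. \<alpha> j * (?F (int s - j) * ?F (int s + j))))"
  proof (rule sum.cong, simp)
    \<comment> \<open>Widening the range of j from s to n adds only zeros, since |j| > s makes an
      argument of \<open>inv_qfact\<close> negative; the sums can then be exchanged.\<close>
    fix s assume "s \<in> {..n}"
    then have "\<beta> s = (\<Sum>j=-int n..int n. \<alpha> j * (?F (int s - j) * ?F (int s + j)))"
      using ab[unfolded bailey_pair_def, rule_format, of s]
      by (auto intro!: sum.mono_neutral_left)
    then show "p ^ s\<^sup>2 * ?F (int n - int s) * \<beta> s = p ^ s\<^sup>2 * ?F (int n - int s) *
        (\<Sum>j=-int n..int n. \<alpha> j * (?F (int s - j) * ?F (int s + j)))"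
      by simp
  qed
  also have "\<dots> = (\<Sum>j=-int n..int n. \<alpha> j *
      (\<Sum>s\<le>n. p ^ s\<^sup>2 * ?F (int n - int s) * (?F (int s - j) * ?F (int s + j))))"
    unfolding sum_distrib_left by (subst sum.swap) (simp only: mult_ac)
  also have "\<dots> = (\<Sum>j=-int n..int n. p ^ nat (j\<^sup>2) * \<alpha> j * (?F (int n - j) * ?F (int n + j)))"
    by (rule sum.cong, simp, subst q_vandermonde_int[OF p]) (auto simp: mult_ac)
  finally show "(\<Sum>s\<le>n. p ^ s\<^sup>2 * ?F (int n - int s) * \<beta> s) =
      (\<Sum>j=-int n..int n. p ^ nat (j\<^sup>2) * \<alpha> j * (?F (int n - j) * ?F (int n + j)))" .
qed

section \<open>Triangular exponents, the unit Bailey pair and the finite Jacobi triple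
  product\<close>

text \<open>The binomial coefficient j choose 2 continued to negative j; it is never negative and so
  can serve as an exponent.\<close>

definition tri :: "int \<Rightarrow> nat" where
  "tri j = nat (j * (j - 1) div 2)"

lemma tri: "2 * int (tri j) = j * (j - 1)"
proof -
  have "j * (j - 1) \<ge> 0"
    by (cases "j \<ge> 1") (auto simp: mult_nonpos_nonpos)
  moreover have "2 dvd j * (j - 1)"
    by simp
  ultimately show ?thesis
    unfolding tri_def by (metis dvd_mult_div_cancel int_nat_eq pos_imp_zdiv_nonneg_iff zero_less_numeral)
qed

lemma two_mult_choose_two: "2 * int (k choose 2) = int k * (int k - 1)"
proof (induction k)
  case (Suc k)
  then show ?case
    by (simp add: numeral_2_eq_2 algebra_simps)
qed simp

text \<open>\<open>q_binomial\<close> with 2 n factors and u = p^n, reindexed by k = n + j. As (k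
  choose 2) + n (2 n - k) = n^2 + (n choose 2) + (j choose 2), the part free of j becomes the
  prefactor.\<close>

lemma q_binomial_bilateral:
  fixes p x :: "'a::idom fps"
  assumes p: "fps_nth p 0 = 0"
  shows "p ^ (n\<^sup>2 + (n choose 2)) * (\<Sum>j=-int n..int n. p ^ tri j * x ^ nat (int n + j) *
            (inv_qfact p (int n - j) * inv_qfact p (int n + j)))
    = inv_qfact p (int (2 * n)) * (\<Prod>i<2 * n. p ^ n + x * p ^ i)"
proof -
  let ?F = "inv_qfact p"
  let ?N = "2 * n"
  have "?F (int ?N) * (\<Prod>i<?N. p ^ n + x * p ^ i) =
     (\<Sum>k\<le>?N. p ^ (k choose 2) * x ^ k * (p ^ n) ^ (?N - k) * (?F (int ?N - int k) * ?F (int k)))"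
    by (rule q_binomial[OF p, symmetric])
  also have "\<dots> = (\<Sum>j=-int n..int n. p ^ (n\<^sup>2 + (n choose 2)) *
      (p ^ tri j * x ^ nat (int n + j) * (?F (int n - j) * ?F (int n + j))))"
  proof (rule sum.reindex_bij_witness[of _ "\<lambda>j. nat (int n + j)" "\<lambda>k. int k - int n"])
    fix k assume "k \<in> {..?N}"
    then have k: "k \<le> ?N" by simp
    define j where "j = int k - int n"
    have "2 * int ((k choose 2) + n * (?N - k)) = 2 * int (n\<^sup>2 + (n choose 2) + tri j)"
      using k by (simp add: distrib_left two_mult_choose_two tri of_nat_diff j_def)
        (simp add: power2_eq_square algebra_simps)
    then have "(k choose 2) + n * (?N - k) = n\<^sup>2 + (n choose 2) + tri j"
      by (simp only: mult_cancel_left of_nat_eq_iff) simp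
    then have "p ^ (k choose 2) * (p ^ n) ^ (?N - k) = p ^ (n\<^sup>2 + (n choose 2)) * p ^ tri j"
      by (simp only: power_add[symmetric] power_mult[symmetric])
    moreover have "nat (int n + j) = k" "int n - j = int ?N - int k" "int n + j = int k"
      by (auto simp: j_def)
    ultimately show "p ^ (n\<^sup>2 + (n choose 2)) * (p ^ tri (int k - int n) * x ^ nat (int n + (int k - int n)) *
        (?F (int n - (int k - int n)) * ?F (int n + (int k - int n)))) =
      p ^ (k choose 2) * x ^ k * (p ^ n) ^ (?N - k) * (?F (int ?N - int k) * ?F (int k))"
      unfolding j_def[symmetric] by (simp only: mult_ac)
  qed auto
  finally show ?thesis
    by (simp only: sum_distrib_left)
qed

lemma minus_one_power_shift:
  assumes "- int n \<le> j"
  shows "(- 1) ^ nat (int n + j) = (- 1) ^ n * (- 1 :: 'a::comm_ring_1) ^ nat \<bar>j\<bar>"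
proof (cases "j \<ge> 0")
  case True
  then show ?thesis by (simp add: nat_add_distrib power_add)
next
  case False
  then have "n = nat (int n + j) + nat \<bar>j\<bar>"
    using assms by simp
  then have "(- 1 :: 'a) ^ n * (- 1) ^ nat \<bar>j\<bar> = (- 1) ^ nat (int n + j) * ((- 1) ^ nat \<bar>j\<bar> * (- 1) ^ nat \<bar>j\<bar>)"
    by (metis mult.assoc power_add)
  then show ?thesis by (simp flip: power_mult_distrib)
qed

text \<open>The bilateral sum at x = -1: for n > 0 the product has the factor p^n - p^n at i = n.
  The power of p in front cancels as p is nonzero.\<close>

lemma bailey_pair_unit:
  fixes p :: "'a::idom fps"
  assumes p: "fps_nth p 0 = 0" "p \<noteq> 0"
  shows "bailey_pair p (\<lambda>j. (- 1) ^ nat \<bar>j\<bar> * p ^ tri j) (\<lambda>n. if n = 0 then 1 else 0)"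
  unfolding bailey_pair_def
proof
  fix n
  let ?F = "inv_qfact p"
  let ?S = "\<Sum>j=-int n..int n. (- 1) ^ nat \<bar>j\<bar> * p ^ tri j * (?F (int n - j) * ?F (int n + j))"
  have "(- 1) ^ n * ?S = (\<Sum>j=-int n..int n. p ^ tri j * (- 1) ^ nat (int n + j) *
            (inv_qfact p (int n - j) * inv_qfact p (int n + j)))"
    unfolding sum_distrib_left by (rule sum.cong) (simp_all add: minus_one_power_shift mult_ac)
  then have *: "p ^ (n\<^sup>2 + (n choose 2)) * ((- 1) ^ n * ?S)
      = ?F (int (2 * n)) * (\<Prod>i<2 * n. p ^ n + (- 1) * p ^ i)"
    using q_binomial_bilateral[OF p(1), of n "- 1"] by simp
  show "(if n = 0 then 1 else 0) = ?S"
  proof (cases "n = 0")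
    case False
    then have "(\<Prod>i<2 * n. p ^ n + (- 1) * p ^ i) = 0"
      by (intro prod_zero) (auto intro!: bexI[of _ n])
    with * have "p ^ (n\<^sup>2 + (n choose 2)) * ((- 1) ^ n * ?S) = 0"
      by (simp only: mult_zero_right)
    then show ?thesis
      using p(2) False by simp
  qed (simp add: tri_def)
qed

text \<open>The bilateral sum with p = X^5 and x = - X^2. The exponents match because 4 (j choose 2)
  + 2 j = 2 j^2; the 2 n factors give n of residue 2 and n of residue 3 modulo 5.\<close>

lemma finite_jacobi_triple:
  fixes X :: "'a::idom fps"
  defines "X \<equiv> fps_X"
  shows "(\<Sum>j=-int n..int n. (- 1) ^ nat \<bar>j\<bar> * X ^ (2 * nat (j\<^sup>2) + tri j) *
            (inv_qfact (X ^ 5) (int n - j) * inv_qfact (X ^ 5) (int n + j)))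
    = inv_qfact (X ^ 5) (int (2 * n)) * (\<Prod>i<n. (1 - X ^ (5 * i + 2)) * (1 - X ^ (5 * i + 3)))"
    (is "?S = _ * ?P")
proof -
  let ?p = "X ^ 5"
  let ?F = "inv_qfact ?p"
  let ?c = "?p ^ (n\<^sup>2 + (n choose 2))"
  have p0: "fps_nth ?p 0 = 0"
    by (simp add: X_def)
  have "(\<Sum>j=-int n..int n. ?p ^ tri j * (- (X ^ 2)) ^ nat (int n + j) * (?F (int n - j) * ?F (int n + j)))
      = (- (X ^ 2)) ^ n * ?S"
    unfolding sum_distrib_left
  proof (rule sum.cong, simp)
    fix j assume "j \<in> {- int n..int n}"
    then have j: "- int n \<le> j" by simp
    then have "2 * int (5 * tri j + 2 * nat (int n + j)) = 2 * int (2 * n + (2 * nat (j\<^sup>2) + tri j))"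
      using tri[of j] by (simp add: power2_eq_square algebra_simps)
    then have "5 * tri j + 2 * nat (int n + j) = 2 * n + (2 * nat (j\<^sup>2) + tri j)"
      by (simp only: mult_cancel_left of_nat_eq_iff) simp
    then have e: "?p ^ tri j * (X ^ 2) ^ nat (int n + j) = (X ^ 2) ^ n * X ^ (2 * nat (j\<^sup>2) + tri j)"
      by (simp only: power_add[symmetric] power_mult[symmetric])
    have "?p ^ tri j * (- (X ^ 2)) ^ nat (int n + j) =
        (- 1) ^ nat (int n + j) * (?p ^ tri j * (X ^ 2) ^ nat (int n + j))"
      by (subst power_minus) (simp only: mult_ac)
    also have "\<dots> = (- (X ^ 2)) ^ n * ((- 1) ^ nat \<bar>j\<bar> * X ^ (2 * nat (j\<^sup>2) + tri j))"
      unfolding e minus_one_power_shift[OF j] power_minus[of "X ^ 2" n] by (simp only: mult_ac)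
    finally show "?p ^ tri j * (- (X ^ 2)) ^ nat (int n + j) * (?F (int n - j) * ?F (int n + j)) =
      (- (X ^ 2)) ^ n * ((- 1) ^ nat \<bar>j\<bar> * X ^ (2 * nat (j\<^sup>2) + tri j) * (?F (int n - j) * ?F (int n + j)))"
      by (simp only: mult.assoc)
  qed
  then have 1: "?c * ((- (X ^ 2)) ^ n * ?S) =
      ?F (int (2 * n)) * (\<Prod>i<2 * n. ?p ^ n + - (X ^ 2) * ?p ^ i)"
    using q_binomial_bilateral[OF p0, of n "- (X ^ 2)"] by simp
  have "(\<Prod>i<2 * n. ?p ^ n + - (X ^ 2) * ?p ^ i) =
      (\<Prod>i<n. ?p ^ n + - (X ^ 2) * ?p ^ i) * (\<Prod>i<n. ?p ^ n + - (X ^ 2) * ?p ^ (n + i))"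
  proof -
    have "(\<Prod>i<n + m. f i) = (\<Prod>i<n. f i) * (\<Prod>i<m. f (n + i))" for m and f :: "nat \<Rightarrow> 'a fps"
      by (induction m) (simp_all add: mult_ac)
    then show ?thesis
      unfolding mult_2 .
  qed
  also have "(\<Prod>i<n. ?p ^ n + - (X ^ 2) * ?p ^ (n + i)) = (\<Prod>i<n. ?p ^ n * (1 - X ^ (5 * i + 2)))"
  proof (rule prod.cong, simp)
    fix i
    have e: "X ^ (5 * i + 2) = X ^ 2 * ?p ^ i"
      by (simp only: power_add power_mult mult.commute[of _ "X ^ 2"])
    have "P + - A * (P * Q) = P * (1 - A * Q)" for P A Q :: "'a fps"
      by (simp add: algebra_simps)
    then show "?p ^ n + - (X ^ 2) * ?p ^ (n + i) = ?p ^ n * (1 - X ^ (5 * i + 2))"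
      unfolding e power_add[of ?p n i] .
  qed
  also have "\<dots> = ?p ^ n\<^sup>2 * (\<Prod>i<n. 1 - X ^ (5 * i + 2))"
    by (simp only: prod.distrib prod_constant card_lessThan power2_eq_square[of n] power_mult)
  \<comment> \<open>For i < n the lower power X^(5 i + 2) is taken out, leaving the exponent 5 n - 5
    i - 2 = 5 (n - 1 - i) + 3 and hence the factors in reverse order.\<close>
  also have "(\<Prod>i<n. ?p ^ n + - (X ^ 2) * ?p ^ i) =
      (\<Prod>i<n. - (X ^ 2) * ?p ^ i * (1 - X ^ (5 * (n - Suc i) + 3)))"
  proof (rule prod.cong, simp)
    fix i assume "i \<in> {..<n}"
    then have "2 + 5 * i + (5 * (n - Suc i) + 3) = 5 * n"
      by auto
    then have "X ^ 2 * ?p ^ i * X ^ (5 * (n - Suc i) + 3) = ?p ^ n"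
      by (simp only: power_add[symmetric] power_mult[symmetric])
    then show "?p ^ n + - (X ^ 2) * ?p ^ i = - (X ^ 2) * ?p ^ i * (1 - X ^ (5 * (n - Suc i) + 3))"
      by (simp add: right_diff_distrib)
  qed
  also have "\<dots> = (- (X ^ 2)) ^ n * ?p ^ (n choose 2) * (\<Prod>i<n. 1 - X ^ (5 * (n - Suc i) + 3))"
  proof -
    have "(\<Prod>i<n. y ^ i) = y ^ (n choose 2)" for y :: "'a fps"
      by (induction n) (simp_all add: numeral_2_eq_2 power_add)
    then show ?thesis
      by (simp only: prod.distrib prod_constant card_lessThan)
  qed
  also have "(\<Prod>i<n. 1 - X ^ (5 * (n - Suc i) + 3)) = (\<Prod>i<n. 1 - X ^ (5 * i + 3))"
    by (rule prod.nat_diff_reindex)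
  finally have 2: "(\<Prod>i<2 * n. ?p ^ n + - (X ^ 2) * ?p ^ i) =
      (- (X ^ 2)) ^ n * ?p ^ (n choose 2) * (\<Prod>i<n. 1 - X ^ (5 * i + 3)) *
      (?p ^ n\<^sup>2 * (\<Prod>i<n. 1 - X ^ (5 * i + 2)))" .
  have "?c * ((- (X ^ 2)) ^ n * ?S) = ?c * ((- (X ^ 2)) ^ n * (?F (int (2 * n)) * ?P))"
    unfolding 1 2 unfolding prod.distrib power_add[of ?p] by (simp only: mult_ac)
  moreover have "?c \<noteq> 0" "(- (X ^ 2)) ^ n \<noteq> 0"
    by (simp_all add: X_def)
  ultimately show ?thesis
    by (simp only: mult_cancel_left simp_thms)
qed

section \<open>Congruence modulo powers of the series variable, and limits\<close>

text \<open>Agreement of the coefficients below n, put as divisibility so that it passes through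
  sums and products.\<close>

definition fps_cong :: "nat \<Rightarrow> 'a::comm_ring_1 fps \<Rightarrow> 'a fps \<Rightarrow> bool" where
  "fps_cong n f g \<longleftrightarrow> fps_X ^ n dvd f - g"

lemma fps_cong_refl [simp]: "fps_cong n f f"
  by (simp add: fps_cong_def)

lemma fps_cong_sym: "fps_cong n f g \<Longrightarrow> fps_cong n g f"
  unfolding fps_cong_def by (subst dvd_minus_iff[symmetric]) simp

lemma fps_cong_trans [trans]: "fps_cong n f g \<Longrightarrow> fps_cong n g h \<Longrightarrow> fps_cong n f h"
  unfolding fps_cong_def by (drule (1) dvd_add) simp

lemma fps_cong_mult:
  assumes "fps_cong n f f'" "fps_cong n g g'"
  shows "fps_cong n (f * g) (f' * g')"
proof -
  have "f * g - f' * g' = (f - f') * g + f' * (g - g')"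
    by (simp add: algebra_simps)
  then show ?thesis
    using assms by (simp add: fps_cong_def)
qed

lemma fps_cong_sum:
  "(\<And>i. i \<in> A \<Longrightarrow> fps_cong n (f i) (g i)) \<Longrightarrow> fps_cong n (sum f A) (sum g A)"
  unfolding fps_cong_def by (simp add: dvd_sum flip: sum_subtractf)

text \<open>A factor of order m raises the precision by m; this offsets the lower precision of
  factorials with shifted arguments.\<close>

lemma fps_cong_power_mult:
  assumes "fps_cong n f g" "N \<le> m + n"
  shows "fps_cong N (fps_X ^ m * f) (fps_X ^ m * g)"
proof -
  have "fps_X ^ N dvd (fps_X ^ m * fps_X ^ n :: 'a fps)"
    unfolding power_add[symmetric] by (rule le_imp_power_dvd) (rule assms(2))
  also have "\<dots> dvd fps_X ^ m * (f - g)"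
    using assms(1) by (intro mult_dvd_mono) (simp_all add: fps_cong_def)
  finally show ?thesis
    by (simp add: fps_cong_def right_diff_distrib)
qed

lemma fps_cong_cancel:
  assumes "fps_cong n (u * f) (u * g)" "v * u = 1"
  shows "fps_cong n f g"
proof -
  have "fps_cong n (v * (u * f)) (v * (u * g))"
    by (intro fps_cong_mult assms fps_cong_refl)
  then show ?thesis
    by (simp add: assms(2) flip: mult.assoc)
qed

lemma fps_cong_nth:
  assumes "fps_cong n f g" "i < n"
  shows "fps_nth f i = fps_nth g i"
proof -
  obtain h where "f - g = fps_X ^ n * h"
    using assms(1) by (auto simp: fps_cong_def)
  then have "fps_nth (f - g) i = 0"
    using assms(2) by (simp add: fps_X_power_mult_nth)
  then show ?thesis by simp
qed

text \<open>Convergence is eventual equality of each coefficient, and coefficient i agrees once n >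
  i.\<close>

lemma tendsto_fps_cong:
  fixes L :: "'a::comm_ring_1 fps"
  assumes "f \<longlonglongrightarrow> L" "\<And>n. fps_cong n (f n) (g n)"
  shows "g \<longlonglongrightarrow> L"
  unfolding tendsto_fps_iff
proof
  fix i
  have "\<forall>\<^sub>F n in sequentially. fps_nth (f n) i = fps_nth L i"
    using assms(1) by (simp add: tendsto_fps_iff)
  then show "\<forall>\<^sub>F n in sequentially. fps_nth (g n) i = fps_nth L i"
    using eventually_gt_at_top[of i]
  proof eventually_elim
    case (elim n)
    then show ?case
      using fps_cong_nth[OF assms(2)] by metis
  qed
qed

text \<open>Coefficient i of a product involves only coefficients up to i, so finitely many eventual
  equalities suffice.\<close>

lemma tendsto_fps_affine:
  fixes L :: "'a::comm_ring_1 fps"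
  assumes "f \<longlonglongrightarrow> L"
  shows "(\<lambda>n. c * (f n - b)) \<longlonglongrightarrow> c * (L - b)"
  unfolding tendsto_fps_iff
proof
  fix i
  have "\<forall>\<^sub>F n in sequentially. \<forall>k\<in>{..i}. fps_nth (f n) k = fps_nth L k"
    using assms by (simp add: tendsto_fps_iff eventually_ball_finite)
  then show "\<forall>\<^sub>F n in sequentially. fps_nth (c * (f n - b)) i = fps_nth (c * (L - b)) i"
    by eventually_elim (simp add: fps_mult_nth)
qed

text \<open>Raising the index from n to n + 1 changes the inverse factorial by a multiple of
  p^(n+1), hence of X^k for n >= k; both sides are compared with index k.\<close>

lemma inv_qfact_cong:
  fixes p :: "'a::comm_ring_1 fps"
  assumes p: "fps_X dvd p" and "k \<le> m" "k \<le> n"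
  shows "fps_cong k (inv_qfact p (int m)) (inv_qfact p (int n))"
proof -
  have p0: "fps_nth p 0 = 0"
    using p by auto
  have *: "fps_cong k (inv_qfact p (int n)) (inv_qfact p (int k))" if "k \<le> n" for n
    using that
  proof (induction n rule: dec_induct)
    case (step n)
    have "inv_qfact p (int (Suc n)) - inv_qfact p (int n) = p ^ Suc n * inv_qfact p (int (Suc n))"
      using inv_qfact_pred[OF p0, of "Suc n"] by (simp add: algebra_simps)
    moreover have "fps_X ^ k dvd p ^ Suc n"
      using step.hyps by (meson dvd_trans dvd_power_same[OF p] le_imp_power_dvd le_SucI)
    ultimately have "fps_cong k (inv_qfact p (int (Suc n))) (inv_qfact p (int n))"
      by (simp add: fps_cong_def)
    then show ?case
      using step.IH by (rule fps_cong_trans)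
  qed simp
  show ?thesis
    using *[of m] *[of n] assms by (blast intro: fps_cong_trans fps_cong_sym)
qed

section \<open>The theta sum and the first Rogers-Ramanujan identity\<close>

text \<open>Truncation of the theta series of (-1)^j q^(j (5 j - 1) / 2); the exponent is kept as
  two Bailey steps produce it.\<close>

definition rr_theta :: "nat \<Rightarrow> 'a::comm_ring_1 fps" where
  "rr_theta n = (\<Sum>j=-int n..int n. (- 1) ^ nat \<bar>j\<bar> * fps_X ^ (2 * nat (j\<^sup>2) + tri j))"

text \<open>Moving the factorial arguments from n - j and n + j to n is exact only modulo X^(n-|j|);
  the exponent, at least j^2, supplies the missing order |j|.\<close>

lemma rr_theta_cong:
  fixes p :: "'a::comm_ring_1 fps"
  assumes p: "fps_X dvd p"
  shows "fps_cong n (\<Sum>j=-int n..int n. (- 1) ^ nat \<bar>j\<bar> * fps_X ^ (2 * nat (j\<^sup>2) + tri j) *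
            (inv_qfact p (int n - j) * inv_qfact p (int n + j)))
          (inv_qfact p (int n) * (inv_qfact p (int n) * rr_theta n))"
proof -
  let ?F = "inv_qfact p"
  have "fps_cong n ((- 1) ^ nat \<bar>j\<bar> * (fps_X ^ (2 * nat (j\<^sup>2) + tri j) * (?F (int n - j) * ?F (int n + j))))
      ((- 1) ^ nat \<bar>j\<bar> * (fps_X ^ (2 * nat (j\<^sup>2) + tri j) * (?F (int n) * ?F (int n))))"
    if j: "j \<in> {-int n..int n}" for j
  proof (intro fps_cong_power_mult fps_cong_mult fps_cong_refl)
    have "k \<le> k\<^sup>2" for k :: nat
      by (cases k) (simp_all add: power2_eq_square)
    then have "nat \<bar>j\<bar> \<le> nat \<bar>j\<bar> ^ 2" .
    also have "nat \<bar>j\<bar> ^ 2 = nat (j\<^sup>2)"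
      by (simp flip: nat_power_eq)
    finally show "n \<le> 2 * nat (j\<^sup>2) + tri j + (n - nat \<bar>j\<bar>)"
      by simp
    have "fps_cong (n - nat \<bar>j\<bar>) (?F (int (nat (int n - j)))) (?F (int n))"
      using j by (intro inv_qfact_cong p) auto
    then show "fps_cong (n - nat \<bar>j\<bar>) (?F (int n - j)) (?F (int n))"
      using j by simp
    have "fps_cong (n - nat \<bar>j\<bar>) (?F (int (nat (int n + j)))) (?F (int n))"
      using j by (intro inv_qfact_cong p) auto
    then show "fps_cong (n - nat \<bar>j\<bar>) (?F (int n + j)) (?F (int n))"
      using j by simp
  qed
  then have "fps_cong n
      (\<Sum>j=-int n..int n. (- 1) ^ nat \<bar>j\<bar> * (fps_X ^ (2 * nat (j\<^sup>2) + tri j) * (?F (int n - j) * ?F (int n + j))))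
      (\<Sum>j=-int n..int n. (- 1) ^ nat \<bar>j\<bar> * (fps_X ^ (2 * nat (j\<^sup>2) + tri j) * (?F (int n) * ?F (int n))))"
    by (rule fps_cong_sum)
  moreover have "(\<Sum>j=-int n..int n. (- 1) ^ nat \<bar>j\<bar> * (fps_X ^ (2 * nat (j\<^sup>2) + tri j) * (?F (int n) * ?F (int n))))
      = ?F (int n) * (?F (int n) * rr_theta n)"
    unfolding rr_theta_def sum_distrib_left by (simp only: mult_ac)
  ultimately show ?thesis
    by (simp only: mult.assoc)
qed

lemma rr_bailey:
  fixes X :: "'a::idom fps"
  defines "X \<equiv> fps_X"
  shows "(\<Sum>s\<le>n. X ^ s\<^sup>2 * inv_qfact X (int n - int s) * inv_qfact X (int s)) =
    (\<Sum>j=-int n..int n. (- 1) ^ nat \<bar>j\<bar> * X ^ (2 * nat (j\<^sup>2) + tri j) *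
            (inv_qfact X (int n - j) * inv_qfact X (int n + j)))"
proof -
  have X: "fps_nth X 0 = 0" "X \<noteq> 0"
    by (simp_all add: X_def)
  \<comment> \<open>The first Bailey step collapses, as the unit pair has
    \<open>\<beta> s = 0\<close> unless s = 0. Each of the two steps contributes X^(j^2).\<close>
  have b: "(\<Sum>s\<le>n. X ^ s\<^sup>2 * inv_qfact X (int n - int s) * (if s = 0 then 1 else 0)) =
      inv_qfact X (int n)" for n
    by (subst sum.mono_neutral_right[of _ "{0}"]) auto
  have "bailey_pair X (\<lambda>j. X ^ nat (j\<^sup>2) * (X ^ nat (j\<^sup>2) * ((- 1) ^ nat \<bar>j\<bar> * X ^ tri j)))
      (\<lambda>n. \<Sum>s\<le>n. X ^ s\<^sup>2 * inv_qfact X (int n - int s) * inv_qfact X (int s))"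
    using bailey_step[OF X(1) bailey_step[OF X(1) bailey_pair_unit[OF X]]] unfolding b .
  then show ?thesis
    unfolding bailey_pair_def by (simp add: power_add mult_2 mult_ac)
qed

definition rr_sum :: "nat \<Rightarrow> 'a::comm_ring_1 fps" where
  "rr_sum n = (\<Sum>s\<le>n. fps_X ^ s\<^sup>2 * inv_qfact fps_X (int s))"

text \<open>After multiplication by 1 / (q)_n the partial sum is congruent to the Bailey sum:
  replacing 1 / (q)_(n-s) by 1 / (q)_n costs s orders, which q^(s^2) restores. One factor 1 / (q)_n
  then cancels.\<close>

lemma rr_sum_cong_theta:
  "fps_cong n (rr_sum n) (inv_qfact fps_X (int n) * rr_theta n :: 'a::idom fps)"
proof (rule fps_cong_cancel)
  let ?F = "inv_qfact (fps_X :: 'a fps)"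
  have "fps_cong n (\<Sum>s\<le>n. fps_X ^ s\<^sup>2 * (?F (int n) * ?F (int s)))
      (\<Sum>s\<le>n. fps_X ^ s\<^sup>2 * (?F (int n - int s) * ?F (int s)))"
  proof (intro fps_cong_sum fps_cong_power_mult fps_cong_mult fps_cong_refl)
    fix s assume s: "s \<in> {..n}"
    show "fps_cong (n - s) (?F (int n)) (?F (int n - int s))"
      using inv_qfact_cong[of "fps_X :: 'a fps" "n - s" n "n - s"] s by (simp add: of_nat_diff)
    have "s \<le> s\<^sup>2"
      by (simp add: power2_eq_square)
    then show "n \<le> s\<^sup>2 + (n - s)"
      by linarith
  qed
  moreover have "(\<Sum>s\<le>n. fps_X ^ s\<^sup>2 * (?F (int n) * ?F (int s))) = ?F (int n) * rr_sum n"
    by (simp add: rr_sum_def sum_distrib_left mult_ac)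
  moreover have "(\<Sum>s\<le>n. fps_X ^ s\<^sup>2 * (?F (int n - int s) * ?F (int s))) =
     (\<Sum>j=-int n..int n. (- 1) ^ nat \<bar>j\<bar> * fps_X ^ (2 * nat (j\<^sup>2) + tri j) *
            (?F (int n - j) * ?F (int n + j)))"
    unfolding rr_bailey[symmetric] by (simp only: mult.assoc)
  ultimately show "fps_cong n (?F (int n) * rr_sum n) (?F (int n) * (?F (int n) * rr_theta n))"
    using rr_theta_cong[of "fps_X :: 'a fps" n] by (auto intro: fps_cong_trans)
  show "(\<Prod>i=1..n. 1 - fps_X ^ i) * ?F (int n) = 1"
    using inv_qfact_mult[of fps_X n] by (simp add: mult.commute)
qed

text \<open>Modulo X^n, the finite triple product with base p = X^5 has the factor 1 / (p; p)_n
  twice on the theta side and once on the product side; one copy cancels and the other moves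
  across.\<close>

lemma rr_theta_cong_prod:
  "fps_cong n (rr_theta n :: 'a::idom fps)
    ((\<Prod>i=1..n. 1 - (fps_X ^ 5) ^ i) * (\<Prod>i<n. (1 - fps_X ^ (5 * i + 2)) * (1 - fps_X ^ (5 * i + 3))))"
  (is "fps_cong n _ (?Q * ?P)")
proof -
  let ?G = "inv_qfact ((fps_X :: 'a fps) ^ 5)"
  have p: "(fps_X :: 'a fps) dvd fps_X ^ 5" "fps_nth ((fps_X :: 'a fps) ^ 5) 0 = 0"
    by simp_all
  have G: "?Q * ?G (int n) = 1"
    using inv_qfact_mult[OF p(2), of n] by (simp add: mult.commute)
  have "fps_cong n (?G (int n) * (?G (int n) * rr_theta n)) (?G (int (2 * n)) * ?P)"
    using rr_theta_cong[OF p(1), of n] unfolding finite_jacobi_triple by (rule fps_cong_sym)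
  also have "fps_cong n (?G (int (2 * n)) * ?P) (?G (int n) * ?P)"
    by (intro fps_cong_mult inv_qfact_cong p fps_cong_refl) simp_all
  finally have "fps_cong n (?G (int n) * rr_theta n) ?P"
    using G by (rule fps_cong_cancel)
  then have "fps_cong n (?Q * (?G (int n) * rr_theta n)) (?Q * ?P)"
    by (intro fps_cong_mult fps_cong_refl)
  then show ?thesis
    by (simp only: G mult.assoc[symmetric] mult_1_left)
qed

lemma prod_residues_mod_5:
  fixes f :: "nat \<Rightarrow> 'a::comm_monoid_mult"
  shows "(\<Prod>i=1..5 * n. f i) = (\<Prod>i=1..n. f (5 * i)) * (\<Prod>i<n. f (5 * i + 2) * f (5 * i + 3)) *
    (\<Prod>i<n. f (5 * i + 1) * f (5 * i + 4))"
proof (induction n)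
  case (Suc n)
  have "{1..5 * Suc n} = insert (5 * n + 1) (insert (5 * n + 2) (insert (5 * n + 3)
      (insert (5 * n + 4) (insert (5 * Suc n) {1..5 * n}))))"
    by auto
  then have "(\<Prod>i=1..5 * Suc n. f i) = f (5 * n + 1) * (f (5 * n + 2) * (f (5 * n + 3) *
      (f (5 * n + 4) * (f (5 * Suc n) * (\<Prod>i=1..5 * n. f i)))))"
    by (simp only:) simp
  also note Suc.IH
  finally show ?case
    by (simp add: mult_ac)
qed simp

lemma rr_sum_cong_prod:
  "fps_cong n (rr_sum n :: 'a::idom fps)
     (\<Prod>k<n. 1 \<oslash> ((1 - fps_X ^ (5 * k + 1)) * (1 - fps_X ^ (5 * k + 4))))"
  (is "fps_cong n _ ?D")
proof -
  let ?F = "inv_qfact (fps_X :: 'a fps)"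
  let ?P14 = "\<Prod>k<n. (1 - fps_X ^ (5 * k + 1)) * (1 - (fps_X :: 'a fps) ^ (5 * k + 4))"
  let ?P23 = "\<Prod>k<n. (1 - fps_X ^ (5 * k + 2)) * (1 - (fps_X :: 'a fps) ^ (5 * k + 3))"
  let ?Q = "\<Prod>i=1..n. 1 - ((fps_X :: 'a fps) ^ 5) ^ i"
  have D: "?D * ?P14 = 1"
    unfolding prod.distrib[symmetric]
    by (rule prod.neutral) (simp add: fps_quot_mult_cancel)
  have "fps_cong n (rr_sum n) (?F (int n) * rr_theta n)"
    by (rule rr_sum_cong_theta)
  \<comment> \<open>Raising the index from n to 5 n is harmless modulo X^n and makes the factorial
    consist of complete blocks of residues modulo 5.\<close>
  also have "fps_cong n (?F (int n) * rr_theta n) (?F (int (5 * n)) * (?Q * ?P23))"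
    by (intro fps_cong_mult inv_qfact_cong rr_theta_cong_prod) simp_all
  finally have "fps_cong n (?P14 * rr_sum n) (?P14 * (?F (int (5 * n)) * (?Q * ?P23)))"
    by (intro fps_cong_mult fps_cong_refl)
  also have "?P14 * (?F (int (5 * n)) * (?Q * ?P23)) = ?P14 * ?D"
  proof -
    have "?P14 * (?F (int (5 * n)) * (?Q * ?P23)) =
        ?F (int (5 * n)) * (\<Prod>i=1..5 * n. 1 - fps_X ^ i)"
      unfolding prod_residues_mod_5 power_mult[symmetric] by (simp only: mult_ac)
    also have "\<dots> = 1"
      by (rule inv_qfact_mult) simp
    finally show ?thesis
      using D by (simp only: mult.commute)
  qed
  finally show ?thesis
    using D by (rule fps_cong_cancel)
qed

lemma rr_sum_tendsto: "rr_sum \<longlonglongrightarrow> Abs_fps (\<lambda>n. fps_nth (rr_sum n :: 'a::comm_ring_1 fps) n)"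
proof (rule fps_sequence_converges)
  fix n k :: nat
  assume "n \<le> k"
  then have "n < Suc k ^ 1" by simp
  also have "\<dots> \<le> (Suc k)\<^sup>2"
    by (rule power_increasing) simp_all
  finally show "fps_nth (rr_sum (Suc k) :: 'a fps) n = fps_nth (rr_sum k) n"
    by (simp add: rr_sum_def fps_X_power_mult_nth)
qed

text \<open>The congruences make the limit \<open>L\<close> of the sums also the limit of the
  partial products; it remains to identify \<open>L\<close> as the value of the infinite product,
  which requires \<open>L\<close> to be nonzero.\<close>

lemma rogers_ramanujan_1:
  "rr_sum \<longlonglongrightarrow> (\<Prod>k. 1 \<oslash> ((1 - fps_X ^ (5 * k + 1)) * (1 - fps_X ^ (5 * k + 4))) :: 'a::idom fps)"
proof -
  let ?f = "\<lambda>k. 1 \<oslash> ((1 - fps_X ^ (5 * k + 1)) * (1 - fps_X ^ (5 * k + 4))) :: 'a fps"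
  define L where "L = Abs_fps (\<lambda>n. fps_nth (rr_sum n :: 'a fps) n)"
  have L: "rr_sum \<longlonglongrightarrow> L"
    unfolding L_def by (rule rr_sum_tendsto)
  then have "(\<lambda>n. \<Prod>k<n. ?f k) \<longlonglongrightarrow> L"
    using rr_sum_cong_prod by (rule tendsto_fps_cong)
  then have lim: "(\<lambda>n. \<Prod>k\<le>n. ?f (k + 0)) \<longlonglongrightarrow> L"
    unfolding lessThan_Suc_atMost[symmetric] add_0_right by (rule LIMSEQ_Suc)
  have "fps_nth L 0 = 1"
    by (simp add: L_def rr_sum_def)
  then have "L \<noteq> 0"
    by auto
  \<comment> \<open>\<open>has_prod\<close> also admits the value 0 when some factor is 0; nonzero
    factors exclude that case, which makes the value unique.\<close>
  have nz: "?f k \<noteq> 0" for k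
  proof
    assume "?f k = 0"
    moreover have "fps_nth (?f k) 0 = 1"
      by (subst fps_quot_nth_0) simp_all
    ultimately show False
      by (metis fps_zero_nth zero_neq_one)
  qed
  have "(\<Prod>k. ?f k) = L"
    unfolding prodinf_def
  proof (rule the_equality)
    show "?f has_prod L"
      using lim \<open>L \<noteq> 0\<close> unfolding has_prod_def raw_has_prod_def by blast
    show "L' = L" if "?f has_prod L'" for L'
      using that lim nz unfolding has_prod_def raw_has_prod_def by (blast intro: LIMSEQ_unique)
  qed
  then show ?thesis
    using L by simp
qed

section \<open>Reduction of the identity in M and t to Rogers-Ramanujan\<close>

theorem mainTheorem3:
  fixes M :: nat
  assumes "M + 1 \<ge> 2"
    and "[M + 1 = 1] (mod 5) \<or> [M + 1 = 4] (mod 5)"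
  shows "1 + q * (((\<Sum>i<M. q ^ i) + t * q ^ M) \<oslash> (1 - t * q ^ (M + 1)))
    + (\<Sum>k=2..M. q ^ k\<^sup>2 * (qint (M + 1) \<oslash> (1 - t * q ^ (M + 1)))
                        * (1 \<oslash> (\<Prod>i=2..k. 1 - q ^ i)))
    + (\<Sum>k. q ^ (k + M + 1)\<^sup>2 \<oslash>
              ((1 - t * q ^ (M + 1)) * (\<Prod>i\<in>{1..k + M + 1} - {M + 1}. 1 - q ^ i)))
    = ((1 - q ^ (M + 1)) \<oslash> (1 - t * q ^ (M + 1)))
      * (\<Prod>k. 1 \<oslash> ((1 - q ^ (5 * k + 1)) * (1 - q ^ (5 * k + 4))))"
proof -
  let ?F = "inv_qfact q"
  \<comment> \<open>The common factor c / d is written \<open>e * c\<close>; head, finite sum and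
    tail all become \<open>e * c\<close> times terms of the Rogers-Ramanujan sum.\<close>
  define c where "c = 1 - q ^ (M + 1)"
  define d where "d = 1 - t * q ^ (M + 1)"
  define e where "e = 1 \<oslash> d"
  define L where "L = (\<Prod>k. 1 \<oslash> ((1 - q ^ (5 * k + 1)) * (1 - q ^ (5 * k + 4))))"
  have M: "M \<ge> 1"
    using assms(1) by simp
  have d0: "fps_nth d 0 = 1"
    by (simp add: d_def)
  have ed: "e * d = 1"
    unfolding e_def using d0 by (rule fps_quot_mult_cancel)
  have quot: "f \<oslash> d = e * f" for f
    by (simp add: e_def fps_quot_def)
  have c: "c = (1 - q) * qint (M + 1)"
    unfolding c_def qint_def by (rule one_diff_power_eq)
  have F1: "?F 1 * (1 - q) = 1"
    using inv_qfact_mult[of q 1] by simp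
  \<comment> \<open>The product from i = 2 lacks the factor 1 - q, which together with [M+1]_q gives
    \<open>c\<close>.\<close>
  have F2: "1 \<oslash> (\<Prod>i=2..k. 1 - q ^ i) = (1 - q) * ?F (int k)" if "k \<ge> 2" for k
  proof (rule sym, rule fps_quot_eq_iff[THEN iffD2])
    show "fps_nth (\<Prod>i=2..k. 1 - q ^ i) 0 = 1"
      by (rule fps_nth_0_prod_eq_1) simp
    have P: "(1 - q) * (\<Prod>i=2..k. 1 - q ^ i) = (\<Prod>i=1..k. 1 - q ^ i)"
      using that prod.atLeast_Suc_atMost[of 1 k "\<lambda>i. 1 - q ^ i"] by (simp add: numeral_2_eq_2)
    have "(1 - q) * ?F (int k) * (\<Prod>i=2..k. 1 - q ^ i) = ?F (int k) * (\<Prod>i=1..k. 1 - q ^ i)"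
      unfolding P[symmetric] by (simp only: mult_ac)
    also have "\<dots> = 1"
      by (rule inv_qfact_mult) simp
    finally show "(1 - q) * ?F (int k) * (\<Prod>i=2..k. 1 - q ^ i) = 1" .
  qed
  have head: "1 + q * (((\<Sum>i<M. q ^ i) + t * q ^ M) \<oslash> d) = e * c * (1 + q * ?F 1)"
  proof -
    have "1 + q * (((\<Sum>i<M. q ^ i) + t * q ^ M) \<oslash> d) = e * (d + q * ((\<Sum>i<M. q ^ i) + t * q ^ M))"
      unfolding quot distrib_left ed by (simp only: mult_ac)
    \<comment> \<open>The terms with t cancel; as [M+1]_q is \<open>c * ?F 1\<close>, the terms k =
      0 and k = 1 appear.\<close>
    also have "d + q * ((\<Sum>i<M. q ^ i) + t * q ^ M) = c + q * qint (M + 1)"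
      by (simp add: d_def c_def qint_def algebra_simps)
    also have "c + q * qint (M + 1) = c + q * (qint (M + 1) * (?F 1 * (1 - q)))"
      unfolding F1 by simp
    also have "\<dots> = c * (1 + q * ?F 1)"
      unfolding c by (simp only: distrib_left mult_1_right mult_1_left mult_ac)
    finally show ?thesis
      by (simp only: mult.assoc)
  qed
  have middle: "(\<Sum>k=2..M. q ^ k\<^sup>2 * (qint (M + 1) \<oslash> d) * (1 \<oslash> (\<Prod>i=2..k. 1 - q ^ i)))
      = e * c * (\<Sum>k=2..M. q ^ k\<^sup>2 * ?F (int k))"
    unfolding sum_distrib_left
    by (rule sum.cong) (simp_all add: F2 quot c mult_ac)
  have rr_M: "1 + q * ?F 1 + (\<Sum>k=2..M. q ^ k\<^sup>2 * ?F (int k)) = rr_sum M"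
    unfolding rr_sum_def atMost_atLeast0 using M
    by (simp add: sum.atLeast_Suc_atMost[of 0 M] sum.atLeast_Suc_atMost[of "Suc 0" M] numeral_2_eq_2 add.assoc)
  \<comment> \<open>The omitted factor i = M + 1 is \<open>c\<close>; restoring it completes the
    q-factorial.\<close>
  have tail: "q ^ (k + M + 1)\<^sup>2 \<oslash> (d * (\<Prod>i\<in>{1..k + M + 1} - {M + 1}. 1 - q ^ i))
      = e * c * (q ^ (k + M + 1)\<^sup>2 * ?F (int (k + M + 1)))" for k
  proof (rule sym, rule fps_quot_eq_iff[THEN iffD2])
    let ?P = "\<Prod>i\<in>{1..k + M + 1} - {M + 1}. 1 - q ^ i"
    have "fps_nth ?P 0 = 1"
      by (rule fps_nth_0_prod_eq_1) simp
    then show "fps_nth (d * ?P) 0 = 1"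
      by (simp add: d0)
    have "c * ?P = (\<Prod>i=1..k + M + 1. 1 - q ^ i)"
      unfolding c_def by (rule prod.remove[symmetric]) simp_all
    then have F: "?F (int (k + M + 1)) * (c * ?P) = 1"
      by (simp only: inv_qfact_mult fps_X_nth) (rule inv_qfact_mult, simp)
    have "e * c * (q ^ (k + M + 1)\<^sup>2 * ?F (int (k + M + 1))) * (d * ?P)
        = q ^ (k + M + 1)\<^sup>2 * (e * d) * (?F (int (k + M + 1)) * (c * ?P))"
      by (simp only: mult_ac)
    then show "e * c * (q ^ (k + M + 1)\<^sup>2 * ?F (int (k + M + 1))) * (d * ?P) = q ^ (k + M + 1)\<^sup>2"
      unfolding F ed by simp
  qed
  have partial: "(\<Sum>k<n. q ^ (k + M + 1)\<^sup>2 * ?F (int (k + M + 1))) = rr_sum (n + M) - rr_sum M" for n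
    by (induction n) (simp_all add: rr_sum_def)
  have "(\<lambda>n. rr_sum (n + M)) \<longlonglongrightarrow> L"
    unfolding L_def by (rule LIMSEQ_ignore_initial_segment) (rule rogers_ramanujan_1)
  then have "(\<lambda>n. \<Sum>k<n. e * c * (q ^ (k + M + 1)\<^sup>2 * ?F (int (k + M + 1)))) \<longlonglongrightarrow> e * c * (L - rr_sum M)"
    unfolding sum_distrib_left[symmetric] partial by (rule tendsto_fps_affine)
  then have series: "(\<Sum>k. e * c * (q ^ (k + M + 1)\<^sup>2 * ?F (int (k + M + 1)))) = e * c * (L - rr_sum M)"
    by (intro sums_unique[symmetric]) (simp only: sums_def)
  \<comment> \<open>Head and finite sum add up to \<open>e * c * rr_sum M\<close>, exactly what the
    tail \<open>e * c * (L - rr_sum M)\<close> subtracts.\<close>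
  show ?thesis
    unfolding d_def[symmetric] c_def[symmetric] L_def[symmetric] head middle tail series rr_M[symmetric]
    by (simp add: quot algebra_simps)
qed

end
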